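(* Let $(X,S)$ be a nondegenerate symmetric set with $S(x,y)=(g_x(y),f_y(x))$. The group homomorphism $\phi:G_X\to \mathrm{Aut}(X)\ltimes \mathbb{Z}^X$ given on generators by $\phi(x)=f_x^{-1}t_x$, $x\in X$, is injective.
   Context: Let $X$ be a nonempty set and $S:X\times X\to X\times X$ a bijection, $S(x,y)=(g_x(y),f_y(x))$. $(X,S)$ is nondegenerate if all maps $f_y,g_x:X\to X$ are bijections; braided if $S^{12}S^{23}S^{12}=S^{23}S^{12}S^{23}$ on $X^3$; involutive if $S^2=\mathrm{id}$; a symmetric set is an involutive braided set. The structure group $G_X$ is the group generated by the elements of $X$ with defining relations $xy=tz$ whenever $S(x,y)=(t,z)$. $\mathrm{Aut}(X)$ is the group of permutations of $X$, $\mathbb{Z}^X$ is the free abelian group spanned by $X$ (finitely supported combinations), with generator $t_x$ corresponding to $x\in X$. $M_X=\mathrm{Aut}(X)\ltimes\mathbb{Z}^X$ is the semidirect product: its elements are $st$ with $s\in \mathrm{Aut}(X)$, $t\in\mathbb{Z}^X$, with $s\,t_x=t_{s(x)}\,s$. For a nondegenerate symmetric set the assignment $x\mapsto f_x^{-1}t_x$ extends to a group homomorphism $\phi:G_X\to M_X$. *)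

theory Defs
  imports "HOL-Algebra.Bij" "HOL-Algebra.Free_Abelian_Groups"
begin

section \<open>Set-theoretic solutions of the braid relation\<close>

text \<open>The components of \<open>S (x, y) = (g\<^sub>x y, f\<^sub>y x)\<close>.\<close>

definition g_map :: "('a \<times> 'a \<Rightarrow> 'a \<times> 'a) \<Rightarrow> 'a \<Rightarrow> 'a \<Rightarrow> 'a" where
  "g_map S x y = fst (S (x, y))"

definition f_map :: "('a \<times> 'a \<Rightarrow> 'a \<times> 'a) \<Rightarrow> 'a \<Rightarrow> 'a \<Rightarrow> 'a" where
  "f_map S y x = snd (S (x, y))"

definition nondegenerate :: "'a set \<Rightarrow> ('a \<times> 'a \<Rightarrow> 'a \<times> 'a) \<Rightarrow> bool" where
  "nondegenerate X S \<longleftrightarrow>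
     (\<forall>y\<in>X. bij_betw (f_map S y) X X) \<and> (\<forall>x\<in>X. bij_betw (g_map S x) X X)"

definition S12 :: "('a \<times> 'a \<Rightarrow> 'a \<times> 'a) \<Rightarrow> 'a \<times> 'a \<times> 'a \<Rightarrow> 'a \<times> 'a \<times> 'a" where
  "S12 S = (\<lambda>(x, y, z). case S (x, y) of (a, b) \<Rightarrow> (a, b, z))"

definition S23 :: "('a \<times> 'a \<Rightarrow> 'a \<times> 'a) \<Rightarrow> 'a \<times> 'a \<times> 'a \<Rightarrow> 'a \<times> 'a \<times> 'a" where
  "S23 S = (\<lambda>(x, y, z). case S (y, z) of (b, c) \<Rightarrow> (x, b, c))"

definition braided :: "'a set \<Rightarrow> ('a \<times> 'a \<Rightarrow> 'a \<times> 'a) \<Rightarrow> bool" where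
  "braided X S \<longleftrightarrow>
     (\<forall>p \<in> X \<times> X \<times> X. S12 S (S23 S (S12 S p)) = S23 S (S12 S (S23 S p)))"

definition involutive :: "'a set \<Rightarrow> ('a \<times> 'a \<Rightarrow> 'a \<times> 'a) \<Rightarrow> bool" where
  "involutive X S \<longleftrightarrow> (\<forall>p \<in> X \<times> X. S (S p) = p)"

definition symmetric_set :: "'a set \<Rightarrow> ('a \<times> 'a \<Rightarrow> 'a \<times> 'a) \<Rightarrow> bool" where
  "symmetric_set X S \<longleftrightarrow>
     X \<noteq> {} \<and> bij_betw S (X \<times> X) (X \<times> X) \<and> braided X S \<and> involutive X S"

section \<open>Groups given by generators and relations\<close>

text \<open>A letter \<open>(True, x)\<close> stands for the generator \<open>x\<close> and \<open>(False, x)\<close> for its formal inverse.\<close>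

type_synonym 'a word = "(bool \<times> 'a) list"

definition words :: "'a set \<Rightarrow> 'a word set" where
  "words X = lists (UNIV \<times> X)"

inductive_set pres_rel :: "'a set \<Rightarrow> ('a word \<times> 'a word) set \<Rightarrow> ('a word \<times> 'a word) set"
  for X R where
  relation: "(u, v) \<in> R \<Longrightarrow> u \<in> words X \<Longrightarrow> v \<in> words X \<Longrightarrow> (u, v) \<in> pres_rel X R"
| cancel: "x \<in> X \<Longrightarrow> ([(b, x), (\<not> b, x)], []) \<in> pres_rel X R"
| refl: "u \<in> words X \<Longrightarrow> (u, u) \<in> pres_rel X R"
| sym: "(u, v) \<in> pres_rel X R \<Longrightarrow> (v, u) \<in> pres_rel X R"
| trans: "(u, v) \<in> pres_rel X R \<Longrightarrow> (v, w) \<in> pres_rel X R \<Longrightarrow> (u, w) \<in> pres_rel X R"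
| append: "(u, v) \<in> pres_rel X R \<Longrightarrow> (u', v') \<in> pres_rel X R \<Longrightarrow>
    (u @ u', v @ v') \<in> pres_rel X R"

definition presented_group ::
    "'a set \<Rightarrow> ('a word \<times> 'a word) set \<Rightarrow> 'a word set monoid" where
  "presented_group X R =
     \<lparr>carrier = words X // pres_rel X R,
      mult = \<lambda>A B. \<Union>a\<in>A. \<Union>b\<in>B. pres_rel X R `` {a @ b},
      one = pres_rel X R `` {[]}\<rparr>"

definition presented_gen ::
    "'a set \<Rightarrow> ('a word \<times> 'a word) set \<Rightarrow> 'a \<Rightarrow> 'a word set" where
  "presented_gen X R x = pres_rel X R `` {[(True, x)]}"

section \<open>The structure group\<close>

definition structure_relations ::
    "'a set \<Rightarrow> ('a \<times> 'a \<Rightarrow> 'a \<times> 'a) \<Rightarrow> ('a word \<times> 'a word) set" where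
  "structure_relations X S =
     {([(True, x), (True, y)], [(True, t), (True, z)]) |x y t z.
        x \<in> X \<and> y \<in> X \<and> S (x, y) = (t, z)}"

definition structure_group ::
    "'a set \<Rightarrow> ('a \<times> 'a \<Rightarrow> 'a \<times> 'a) \<Rightarrow> 'a word set monoid" where
  "structure_group X S = presented_group X (structure_relations X S)"

definition structure_gen ::
    "'a set \<Rightarrow> ('a \<times> 'a \<Rightarrow> 'a \<times> 'a) \<Rightarrow> 'a \<Rightarrow> 'a word set" where
  "structure_gen X S = presented_gen X (structure_relations X S)"

section \<open>The semidirect product of Aut(X) and the free abelian group on X\<close>

definition perm_act :: "('a \<Rightarrow> 'a) \<Rightarrow> ('a \<Rightarrow>\<^sub>0 int) \<Rightarrow> ('a \<Rightarrow>\<^sub>0 int)" where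
  "perm_act s = frag_extend (\<lambda>x. frag_of (s x))"

text \<open>The pair \<open>(s, t)\<close> stands for the product \<open>s t\<close>, with the permutation on the left. The
  rule \<open>s t\<^sub>x = t\<^bsub>s(x)\<^esub> s\<close> means \<open>t s' = s' (s'\<^sup>-\<^sup>1 \<cdot> t)\<close>, whence
  \<open>(s t) (s' t') = (s s') ((s'\<^sup>-\<^sup>1 \<cdot> t) + t')\<close>.\<close>

definition aut_semidirect :: "'a set \<Rightarrow> (('a \<Rightarrow> 'a) \<times> ('a \<Rightarrow>\<^sub>0 int)) monoid" where
  "aut_semidirect X =
     \<lparr>carrier = carrier (BijGroup X) \<times> carrier (free_Abelian_group X),
      mult = \<lambda>(s, t) (s', t').
        (s \<otimes>\<^bsub>BijGroup X\<^esub> s',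
         perm_act (inv\<^bsub>BijGroup X\<^esub> s') t \<otimes>\<^bsub>free_Abelian_group X\<^esub> t'),
      one = (\<one>\<^bsub>BijGroup X\<^esub>, \<one>\<^bsub>free_Abelian_group X\<^esub>)\<rparr>"

text \<open>\<open>f\<^sub>x\<^sup>-\<^sup>1 t\<^sub>x\<close>; elements of \<^const>\<open>BijGroup\<close> are extensional, whence the restriction.\<close>

definition phi_gen ::
    "'a set \<Rightarrow> ('a \<times> 'a \<Rightarrow> 'a \<times> 'a) \<Rightarrow> 'a \<Rightarrow> ('a \<Rightarrow> 'a) \<times> ('a \<Rightarrow>\<^sub>0 int)" where
  "phi_gen X S x = (inv\<^bsub>BijGroup X\<^esub> (restrict (f_map S x) X), frag_of x)"

section \<open>Both structures are groups, and the homomorphism exists\<close>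

subsection \<open>Presented groups\<close>

lemma pres_rel_words: "(u, v) \<in> pres_rel X R \<Longrightarrow> u \<in> words X \<and> v \<in> words X"
  by (induction rule: pres_rel.induct) (auto simp: words_def)

lemma equiv_pres_rel: "equiv (words X) (pres_rel X R)"
proof (rule equivI)
  show "pres_rel X R \<subseteq> words X \<times> words X" by (auto dest: pres_rel_words)
  show "refl_on (words X) (pres_rel X R)" by (simp add: refl_on_def pres_rel.refl)
  show "sym (pres_rel X R)" by (blast intro: symI pres_rel.sym)
  show "trans (pres_rel X R)" by (blast intro: transI pres_rel.trans)
qed

lemma presented_mult:
  assumes "u \<in> words X" "v \<in> words X"
  shows "pres_rel X R `` {u} \<otimes>\<^bsub>presented_group X R\<^esub> pres_rel X R `` {v} =
    pres_rel X R `` {u @ v}"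
proof -
  have "pres_rel X R `` {a @ b} = pres_rel X R `` {u @ v}"
    if "(u, a) \<in> pres_rel X R" "(v, b) \<in> pres_rel X R" for a b
    using equiv_class_eq[OF equiv_pres_rel pres_rel.append[OF that]] by simp
  moreover have "(u, u) \<in> pres_rel X R" "(v, v) \<in> pres_rel X R"
    using assms by (auto intro: pres_rel.refl)
  ultimately have "(\<Union>a\<in>pres_rel X R `` {u}. \<Union>b\<in>pres_rel X R `` {v}.
      pres_rel X R `` {a @ b}) = pres_rel X R `` {u @ v}"
    by blast
  then show ?thesis by (simp add: presented_group_def)
qed

lemma presented_left_inv:
  assumes "u \<in> words X"
  shows "\<exists>v\<in>words X. (v @ u, []) \<in> pres_rel X R"
  using assms
proof (induction u)
  case Nil
  then show ?case by (auto simp: words_def intro!: bexI[of _ "[]"] pres_rel.refl)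
next
  case (Cons l u)
  obtain b x where l: "l = (b, x)" by (cases l)
  have x: "x \<in> X" and u: "u \<in> words X" using Cons.prems by (auto simp: words_def l)
  obtain v where v: "v \<in> words X" "(v @ u, []) \<in> pres_rel X R" using Cons.IH u by blast
  have "([(\<not> b, x), (b, x)], []) \<in> pres_rel X R"
    using pres_rel.cancel[OF x, where b = "\<not> b"] by simp
  from pres_rel.append[OF this pres_rel.refl[OF u]]
  have "([(\<not> b, x), (b, x)] @ u, u) \<in> pres_rel X R" by simp
  from pres_rel.append[OF pres_rel.refl[OF v(1)] this]
  have "((v @ [(\<not> b, x)]) @ l # u, v @ u) \<in> pres_rel X R" by (simp add: l)
  then have "((v @ [(\<not> b, x)]) @ l # u, []) \<in> pres_rel X R"
    using v(2) pres_rel.trans by blast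
  moreover have "v @ [(\<not> b, x)] \<in> words X" using v x by (auto simp: words_def)
  ultimately show ?case by blast
qed

lemma group_presented_group: "group (presented_group X R)"
proof (rule groupI)
  let ?G = "presented_group X R"
  have carr: "A \<in> carrier ?G \<longleftrightarrow> (\<exists>u\<in>words X. A = pres_rel X R `` {u})" for A
    by (auto simp: presented_group_def quotient_def)
  have one: "\<one>\<^bsub>?G\<^esub> = pres_rel X R `` {[]}" by (simp add: presented_group_def)
  have nil: "[] \<in> words X" by (simp add: words_def)
  have app: "u @ v \<in> words X" if "u \<in> words X" "v \<in> words X" for u v
    using that by (auto simp: words_def)
  show "\<one>\<^bsub>?G\<^esub> \<in> carrier ?G" using carr one nil by auto
  show "A \<otimes>\<^bsub>?G\<^esub> B \<in> carrier ?G" if "A \<in> carrier ?G" "B \<in> carrier ?G" for A B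
    using that app by (auto simp: carr presented_mult)
  show "A \<otimes>\<^bsub>?G\<^esub> B \<otimes>\<^bsub>?G\<^esub> C = A \<otimes>\<^bsub>?G\<^esub> (B \<otimes>\<^bsub>?G\<^esub> C)"
    if "A \<in> carrier ?G" "B \<in> carrier ?G" "C \<in> carrier ?G" for A B C
    using that app by (auto simp: carr presented_mult)
  show "\<one>\<^bsub>?G\<^esub> \<otimes>\<^bsub>?G\<^esub> A = A" if "A \<in> carrier ?G" for A
    using that nil by (auto simp: carr one presented_mult)
  show "\<exists>B\<in>carrier ?G. B \<otimes>\<^bsub>?G\<^esub> A = \<one>\<^bsub>?G\<^esub>" if A: "A \<in> carrier ?G" for A
  proof -
    obtain u where u: "u \<in> words X" "A = pres_rel X R `` {u}" using A unfolding carr by blast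
    obtain v where v: "v \<in> words X" "(v @ u, []) \<in> pres_rel X R"
      using presented_left_inv u(1) by blast
    have "pres_rel X R `` {v} \<otimes>\<^bsub>?G\<^esub> A = \<one>\<^bsub>?G\<^esub>"
      using equiv_class_eq[OF equiv_pres_rel v(2)] u v by (simp add: presented_mult one)
    then show ?thesis using carr v(1) by blast
  qed
qed

fun word_eval :: "('b, 'm) monoid_scheme \<Rightarrow> ('a \<Rightarrow> 'b) \<Rightarrow> 'a word \<Rightarrow> 'b" where
  "word_eval H h [] = \<one>\<^bsub>H\<^esub>"
| "word_eval H h ((b, x) # w) = (if b then h x else inv\<^bsub>H\<^esub> (h x)) \<otimes>\<^bsub>H\<^esub> word_eval H h w"

lemma presented_group_universal:
  assumes "group H" and h: "h \<in> X \<rightarrow> carrier H"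
    and R: "\<And>u v. (u, v) \<in> R \<Longrightarrow> word_eval H h u = word_eval H h v"
  shows "\<exists>\<phi>\<in>hom (presented_group X R) H. \<forall>x\<in>X. \<phi> (presented_gen X R x) = h x"
proof -
  interpret H: group H by fact
  have hx: "h x \<in> carrier H" if "x \<in> X" for x using h that by auto
  have closed: "word_eval H h u \<in> carrier H" if "u \<in> words X" for u
    using that by (induction u) (auto simp: words_def hx)
  have app: "word_eval H h (u @ v) = word_eval H h u \<otimes>\<^bsub>H\<^esub> word_eval H h v"
    if "u \<in> words X" "v \<in> words X" for u v
    using that
  proof (induction u)
    case Nil
    then show ?case by (simp add: closed)
  next
    case (Cons l u)
    then have "fst l \<in> UNIV" "snd l \<in> X" "u \<in> words X" by (auto simp: words_def)
    with Cons show ?case by (cases l) (auto simp: H.m_assoc hx closed)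
  qed
  have wd: "word_eval H h u = word_eval H h v" if "(u, v) \<in> pres_rel X R" for u v
    using that
  proof (induction rule: pres_rel.induct)
    case (append u v u' v')
    then show ?case using pres_rel_words by (metis app)
  qed (auto simp: R hx)
  define \<phi> where "\<phi> A = word_eval H h (SOME u. u \<in> A)" for A
  have \<phi>: "\<phi> (pres_rel X R `` {u}) = word_eval H h u" if "u \<in> words X" for u
  proof -
    have "(SOME v. v \<in> pres_rel X R `` {u}) \<in> pres_rel X R `` {u}"
      by (rule someI[of _ u]) (use that in \<open>auto intro: pres_rel.refl\<close>)
    then show ?thesis unfolding \<phi>_def using wd by auto
  qed
  have carr: "A \<in> carrier (presented_group X R) \<longleftrightarrow> (\<exists>u\<in>words X. A = pres_rel X R `` {u})" for A
    by (auto simp: presented_group_def quotient_def)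
  have "\<phi> \<in> hom (presented_group X R) H"
  proof (rule homI)
    fix A B assume "A \<in> carrier (presented_group X R)" "B \<in> carrier (presented_group X R)"
    then obtain u v where uv: "u \<in> words X" "A = pres_rel X R `` {u}"
      "v \<in> words X" "B = pres_rel X R `` {v}" using carr by auto
    then have "u @ v \<in> words X" by (auto simp: words_def)
    with uv show "\<phi> (A \<otimes>\<^bsub>presented_group X R\<^esub> B) = \<phi> A \<otimes>\<^bsub>H\<^esub> \<phi> B"
      by (simp add: presented_mult \<phi> app)
  qed (auto simp: carr \<phi> closed)
  moreover have "\<phi> (presented_gen X R x) = h x" if "x \<in> X" for x
    using \<phi>[of "[(True, x)]"] that hx by (simp add: presented_gen_def words_def)
  ultimately show ?thesis by blast
qed

lemma group_structure_group: "group (structure_group X S)"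
  by (simp add: structure_group_def group_presented_group)

subsection \<open>The semidirect product\<close>

lemma perm_act_of [simp]: "perm_act s (frag_of x) = frag_of (s x)"
  by (simp add: perm_act_def)

lemma perm_act_0 [simp]: "perm_act s 0 = 0"
  by (simp add: perm_act_def)

lemma perm_act_add: "perm_act s (t + t') = perm_act s t + perm_act s t'"
  by (simp add: perm_act_def frag_extend_add)

lemma keys_perm_act: "Poly_Mapping.keys (perm_act s t) \<subseteq> s ` Poly_Mapping.keys t"
  using keys_frag_extend[of "\<lambda>x. frag_of (s x)" t] by (auto simp: perm_act_def)

lemma perm_act_mult:
  assumes "s \<in> carrier (BijGroup X)" "s' \<in> carrier (BijGroup X)" "Poly_Mapping.keys t \<subseteq> X"
  shows "perm_act (s \<otimes>\<^bsub>BijGroup X\<^esub> s') t = perm_act s (perm_act s' t)"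
proof -
  have "perm_act s (perm_act s' t) = frag_extend (\<lambda>x. frag_of (s (s' x))) t"
    using frag_extend_compose[of "\<lambda>x. frag_of (s x)" s' t] by (simp add: perm_act_def comp_def)
  also have "\<dots> = perm_act (s \<otimes>\<^bsub>BijGroup X\<^esub> s') t"
    unfolding perm_act_def using assms
    by (intro frag_extend_eq) (auto simp: BijGroup_def compose_def)
  finally show ?thesis by simp
qed

lemma perm_act_one:
  assumes "Poly_Mapping.keys t \<subseteq> X"
  shows "perm_act \<one>\<^bsub>BijGroup X\<^esub> t = t"
proof -
  have "perm_act \<one>\<^bsub>BijGroup X\<^esub> t = frag_extend frag_of t"
    unfolding perm_act_def using assms by (intro frag_extend_eq) (auto simp: BijGroup_def)
  then show ?thesis using frag_expansion[of t] by simp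
qed

lemma perm_act_closed:
  assumes "s \<in> carrier (BijGroup X)" "Poly_Mapping.keys t \<subseteq> X"
  shows "Poly_Mapping.keys (perm_act s t) \<subseteq> X"
proof -
  have "s ` X = X" using assms(1) by (auto simp: BijGroup_def Bij_def bij_betw_def)
  then show ?thesis using keys_perm_act[of s t] assms(2) by blast
qed

lemma carrier_aut_semidirect:
  "(s, t) \<in> carrier (aut_semidirect X) \<longleftrightarrow>
     s \<in> carrier (BijGroup X) \<and> Poly_Mapping.keys t \<subseteq> X"
  by (simp add: aut_semidirect_def)

lemma mult_aut_semidirect:
  "(s, t) \<otimes>\<^bsub>aut_semidirect X\<^esub> (s', t') =
     (s \<otimes>\<^bsub>BijGroup X\<^esub> s', perm_act (inv\<^bsub>BijGroup X\<^esub> s') t + t')"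
  by (simp add: aut_semidirect_def)

lemma one_aut_semidirect: "\<one>\<^bsub>aut_semidirect X\<^esub> = (\<one>\<^bsub>BijGroup X\<^esub>, 0)"
  by (simp add: aut_semidirect_def)

lemma group_aut_semidirect: "group (aut_semidirect X)"
proof -
  interpret B: group "BijGroup X" by (rule group_BijGroup)
  note defs = carrier_aut_semidirect mult_aut_semidirect one_aut_semidirect
  have add: "Poly_Mapping.keys (t + t') \<subseteq> X"
    if "Poly_Mapping.keys t \<subseteq> X" "Poly_Mapping.keys t' \<subseteq> X" for t t' :: "'a \<Rightarrow>\<^sub>0 int"
    using that keys_add[of t t'] by blast
  show ?thesis
  proof (rule groupI, goal_cases)
    case (1 p q)
    then show ?case by (cases p; cases q) (simp add: defs add perm_act_closed)
  next
    case 2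
    then show ?case by (simp add: defs)
  next
    case (3 p q r)
    then show ?case
      by (cases p; cases q; cases r)
         (simp add: defs B.m_assoc B.inv_mult_group perm_act_mult perm_act_add add.assoc)
  next
    case (4 p)
    then show ?case by (cases p) (simp add: defs)
  next
    case (5 p)
    obtain s t where p: "p = (s, t)" by (cases p)
    have s: "s \<in> carrier (BijGroup X)" and t: "Poly_Mapping.keys t \<subseteq> X"
      using 5 by (auto simp: p defs)
    let ?q = "(inv\<^bsub>BijGroup X\<^esub> s, perm_act s (- t))"
    have "perm_act (inv\<^bsub>BijGroup X\<^esub> s) (perm_act s (- t)) = - t"
      using s t perm_act_mult[of "inv\<^bsub>BijGroup X\<^esub> s" X s "- t"] perm_act_one[of "- t" X] by simp
    then have "?q \<otimes>\<^bsub>aut_semidirect X\<^esub> p = \<one>\<^bsub>aut_semidirect X\<^esub>"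
      using s by (simp add: p defs)
    moreover have "?q \<in> carrier (aut_semidirect X)"
      using s t by (simp add: defs perm_act_closed)
    ultimately show ?case by blast
  qed
qed

text \<open>The defining commutation rule \<open>s t\<^sub>x = t\<^bsub>s(x)\<^esub> s\<close>.\<close>

lemma aut_semidirect_commute:
  assumes s: "s \<in> carrier (BijGroup X)" and x: "x \<in> X"
  shows "(s, 0) \<otimes>\<^bsub>aut_semidirect X\<^esub> (\<one>\<^bsub>BijGroup X\<^esub>, frag_of x) =
    (\<one>\<^bsub>BijGroup X\<^esub>, frag_of (s x)) \<otimes>\<^bsub>aut_semidirect X\<^esub> (s, 0)"
proof -
  interpret B: group "BijGroup X" by (rule group_BijGroup)
  have "perm_act (inv\<^bsub>BijGroup X\<^esub> s) (perm_act s (frag_of x)) = frag_of x"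
    using s x perm_act_mult[of "inv\<^bsub>BijGroup X\<^esub> s" X s "frag_of x"]
      perm_act_one[of "frag_of x" X] by simp
  then show ?thesis using s by (simp add: mult_aut_semidirect)
qed

subsection \<open>Existence of the homomorphism\<close>

lemma phi_exists:
  assumes sym: "symmetric_set X S" and nd: "nondegenerate X S"
  shows "\<exists>\<phi>\<in>hom (structure_group X S) (aut_semidirect X).
    \<forall>x\<in>X. \<phi> (structure_gen X S x) = phi_gen X S x"
  unfolding structure_group_def structure_gen_def
proof (rule presented_group_universal)
  interpret B: group "BijGroup X" by (rule group_BijGroup)
  let ?F = "\<lambda>x. restrict (f_map S x) X"
  have F: "?F x \<in> carrier (BijGroup X)" if "x \<in> X" for x
    using nd that by (auto simp: nondegenerate_def BijGroup_def Bij_def)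
  have fX: "f_map S x w \<in> X" if "x \<in> X" "w \<in> X" for x w
    using nd that bij_betwE by (fastforce simp: nondegenerate_def)
  interpret M: group "aut_semidirect X" by (rule group_aut_semidirect)
  show "group (aut_semidirect X)" by (rule group_aut_semidirect)
  show gen: "phi_gen X S \<in> X \<rightarrow> carrier (aut_semidirect X)"
    by (auto simp: phi_gen_def carrier_aut_semidirect F)
  fix u v assume "(u, v) \<in> structure_relations X S"
  then obtain x y t z where uv: "u = [(True, x), (True, y)]" "v = [(True, t), (True, z)]"
    and xy: "x \<in> X" "y \<in> X" and S: "S (x, y) = (t, z)"
    unfolding structure_relations_def by blast
  have SX: "S (a, b) \<in> X \<times> X" if "a \<in> X" "b \<in> X" for a b
    using sym that bij_betwE[of S "X \<times> X" "X \<times> X"] by (auto simp: symmetric_set_def)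
  have tz: "t \<in> X" "z \<in> X" using SX[OF xy] S by auto
  have S': "S (t, z) = (x, y)"
    using sym xy S by (force simp: symmetric_set_def involutive_def)
  have "f_map S y (f_map S x w) = f_map S z (f_map S t w)" if w: "w \<in> X" for w
  proof -
    obtain a b where ab: "S (w, x) = (a, b)" by (cases "S (w, x)")
    obtain c d where cd: "S (b, y) = (c, d)" by (cases "S (b, y)")
    obtain a' b' where ab': "S (w, t) = (a', b')" by (cases "S (w, t)")
    obtain c' d' where cd': "S (b', z) = (c', d')" by (cases "S (b', z)")
    have "S12 S (S23 S (S12 S (w, x, y))) = S23 S (S12 S (S23 S (w, x, y)))"
      using sym w xy by (auto simp: symmetric_set_def braided_def)
    then have "d = d'"
      by (simp add: S12_def S23_def ab cd S ab' cd' split: prod.splits)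
    then show ?thesis by (simp add: f_map_def ab cd ab' cd')
  qed
  then have "?F y \<otimes>\<^bsub>BijGroup X\<^esub> ?F x = ?F z \<otimes>\<^bsub>BijGroup X\<^esub> ?F t"
    using F xy tz fX by (auto simp: BijGroup_def compose_def fun_eq_iff)
  then have inv: "inv\<^bsub>BijGroup X\<^esub> ?F x \<otimes>\<^bsub>BijGroup X\<^esub> inv\<^bsub>BijGroup X\<^esub> ?F y =
      inv\<^bsub>BijGroup X\<^esub> ?F t \<otimes>\<^bsub>BijGroup X\<^esub> inv\<^bsub>BijGroup X\<^esub> ?F z"
    using F xy tz by (simp add: B.inv_mult_group[symmetric])
  have "f_map S y x = z" "f_map S z t = y" using S S' by (auto simp: f_map_def)
  then have "phi_gen X S x \<otimes>\<^bsub>aut_semidirect X\<^esub> phi_gen X S y =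
      phi_gen X S t \<otimes>\<^bsub>aut_semidirect X\<^esub> phi_gen X S z"
    using F xy tz inv by (simp add: phi_gen_def mult_aut_semidirect add.commute)
  moreover have "phi_gen X S a \<in> carrier (aut_semidirect X)" if "a \<in> X" for a
    using gen that by auto
  ultimately show "word_eval (aut_semidirect X) (phi_gen X S) u =
      word_eval (aut_semidirect X) (phi_gen X S) v"
    using xy tz by (simp add: uv)
qed

end

theory Submission
  imports Defs "HOL-Library.Multiset"
begin

text \<open>
  Write \<open>\<phi>(u) = (s\<^sub>u, \<pi>(u))\<close> for \<open>u \<in> G\<^sub>X\<close>. The permutation part twists the translation part:
  \<open>\<pi>(x u) = s\<^sub>u\<^sup>-\<^sup>1(x) + \<pi>(u)\<close> for a generator \<open>x\<close>. Undoing the twist, the operator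
  \<open>A\<^sub>z(u) = s\<^sub>u(z) u\<close> on \<open>G\<^sub>X\<close> translates \<open>\<pi>\<close> by exactly \<open>t\<^sub>z\<close>. Rebuilding \<open>u\<close>
  from \<open>1\<close> with these operators, guided by \<open>\<pi>(u)\<close>, shows that \<open>\<pi>(u) = 0\<close> forces \<open>u = 1\<close>, and
  the kernel of \<open>\<phi>\<close> is trivial. Two facts make it work.

  The operators commute. With \<open>a = s\<^sub>u(x)\<close> and \<open>b = s\<^sub>u(y)\<close> one finds
  \<open>A\<^sub>x(A\<^sub>y(u)) = f\<^sub>b\<^sup>-\<^sup>1(a) b u\<close> and \<open>A\<^sub>y(A\<^sub>x(u)) = f\<^sub>a\<^sup>-\<^sup>1(b) a u\<close>, and involutivity says precisely that
  \<open>S(f\<^sub>b\<^sup>-\<^sup>1(a), b) = (f\<^sub>a\<^sup>-\<^sup>1(b), a)\<close>, so the two products agree by a defining relation. Hence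
  \<open>A\<^sub>M\<close> makes sense for a finite multiset \<open>M\<close> of elements of \<open>X\<close>.

  The operators are injective. If \<open>w = A\<^sub>z(u) = c u\<close> with \<open>c = s\<^sub>u(z)\<close>, then
  \<open>s\<^sub>w(z) = f\<^sub>c\<^sup>-\<^sup>1(c)\<close>, and \<open>c \<mapsto> f\<^sub>c\<^sup>-\<^sup>1(c)\<close> is injective; so \<open>w\<close> and \<open>z\<close> determine \<open>c\<close>, and then \<open>u\<close>.

  Since left multiplication by a generator is an application of some \<open>A\<^sub>z\<close>, every \<open>g\<close> satisfies
  \<open>A\<^sub>N(g) = A\<^sub>P(1)\<close> for multisets with \<open>\<pi>(g) = P - N\<close>. If \<open>\<phi>(g) = 1\<close>, then \<open>P = N\<close>, and
  injectivity of \<open>A\<^sub>P\<close> gives \<open>g = 1\<close>.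
\<close>

section \<open>Induction over a presented group\<close>

lemma presented_gen_closed:
  "x \<in> X \<Longrightarrow> presented_gen X R x \<in> carrier (presented_group X R)"
  by (auto simp: presented_gen_def presented_group_def words_def intro!: quotientI)

lemma presented_group_induct [consumes 1, case_names one gen inv_gen]:
  assumes g: "g \<in> carrier (presented_group X R)"
    and one: "P \<one>\<^bsub>presented_group X R\<^esub>"
    and gen: "\<And>x u. x \<in> X \<Longrightarrow> u \<in> carrier (presented_group X R) \<Longrightarrow> P u \<Longrightarrow>
      P (presented_gen X R x \<otimes>\<^bsub>presented_group X R\<^esub> u)"
    and inv_gen: "\<And>x u. x \<in> X \<Longrightarrow> u \<in> carrier (presented_group X R) \<Longrightarrow> P u \<Longrightarrow>
      P (inv\<^bsub>presented_group X R\<^esub> presented_gen X R x \<otimes>\<^bsub>presented_group X R\<^esub> u)"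
  shows "P g"
proof -
  let ?G = "presented_group X R"
  interpret G: group ?G by (rule group_presented_group)
  have one_eq: "\<one>\<^bsub>?G\<^esub> = pres_rel X R `` {[]}"
    by (simp add: presented_group_def)
  have closed: "pres_rel X R `` {w} \<in> carrier ?G" if "w \<in> words X" for w
    using that by (auto simp: presented_group_def intro!: quotientI)
  have inv_eq: "inv\<^bsub>?G\<^esub> presented_gen X R x = pres_rel X R `` {[(False, x)]}" if x: "x \<in> X" for x
  proof (rule G.inv_equality)
    have w: "[(b, x)] \<in> words X" for b using x by (simp add: words_def)
    have "([(False, x), (True, x)], []) \<in> pres_rel X R"
      using pres_rel.cancel[OF x, of False] by simp
    from equiv_class_eq[OF equiv_pres_rel this]
    show "pres_rel X R `` {[(False, x)]} \<otimes>\<^bsub>?G\<^esub> presented_gen X R x = \<one>\<^bsub>?G\<^esub>"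
      using w by (simp add: presented_gen_def presented_mult one_eq)
    show "presented_gen X R x \<in> carrier ?G" using x by (rule presented_gen_closed)
    show "pres_rel X R `` {[(False, x)]} \<in> carrier ?G" using w by (rule closed)
  qed
  have "P (pres_rel X R `` {w})" if "w \<in> words X" for w
    using that
  proof (induction w)
    case Nil
    then show ?case using one by (simp add: one_eq)
  next
    case (Cons l w)
    obtain b x where l: "l = (b, x)" by (cases l)
    have x: "x \<in> X" and w: "w \<in> words X" using Cons.prems by (auto simp: words_def l)
    have "[(b, x)] \<in> words X" using x by (simp add: words_def)
    from presented_mult[OF this w, of R]
    have split: "pres_rel X R `` {l # w} = pres_rel X R `` {[(b, x)]} \<otimes>\<^bsub>?G\<^esub> pres_rel X R `` {w}"
      by (simp add: l)
    show ?case
      using gen[OF x closed[OF w] Cons.IH[OF w]] inv_gen[OF x closed[OF w] Cons.IH[OF w]]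
      by (cases b) (simp_all only: split inv_eq[OF x], simp_all add: presented_gen_def)
  qed
  then show ?thesis
    using g by (auto simp: presented_group_def quotient_def)
qed

section \<open>Multisets as elements of the free abelian group\<close>

lemma lookup_sum_frag_of:
  "Poly_Mapping.lookup (\<Sum>x\<in>#M. frag_of x) y = int (count M y)"
  by (induction M) (auto simp: lookup_add)

lemma sum_frag_of_inject:
  assumes "(\<Sum>x\<in>#M. frag_of x) = (\<Sum>x\<in>#N. frag_of x)"
  shows "M = N"
proof (rule multiset_eqI)
  fix x
  show "count M x = count N x"
    using arg_cong[OF assms, of "\<lambda>t. Poly_Mapping.lookup t x"] by (simp add: lookup_sum_frag_of)
qed

section \<open>Consequences of involutivity and nondegeneracy\<close>

lemma BijGroup_apply_closed: "s \<in> carrier (BijGroup X) \<Longrightarrow> x \<in> X \<Longrightarrow> s x \<in> X"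
  using bij_betwE[of s X X] by (simp add: BijGroup_def Bij_def)

locale structure_hom =
  fixes X :: "'a set" and S :: "'a \<times> 'a \<Rightarrow> 'a \<times> 'a"
    and \<phi> :: "'a word set \<Rightarrow> ('a \<Rightarrow> 'a) \<times> ('a \<Rightarrow>\<^sub>0 int)"
  assumes symmetric: "symmetric_set X S"
    and nondegenerate: "nondegenerate X S"
    and hom: "\<phi> \<in> hom (structure_group X S) (aut_semidirect X)"
    and phi_generator: "\<And>x. x \<in> X \<Longrightarrow> \<phi> (structure_gen X S x) = phi_gen X S x"
begin

abbreviation "G \<equiv> structure_group X S"
abbreviation "gen \<equiv> structure_gen X S"
abbreviation "perm u \<equiv> fst (\<phi> u)"
abbreviation "transl u \<equiv> snd (\<phi> u)"

sublocale G: group G by (rule group_structure_group)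
sublocale B: group "BijGroup X" by (rule group_BijGroup)
sublocale M: group "aut_semidirect X" by (rule group_aut_semidirect)
sublocale phi: group_hom G "aut_semidirect X" \<phi>
  by unfold_locales (rule hom)

declare phi.hom_mult [simp del]

lemma gen_closed: "x \<in> X \<Longrightarrow> gen x \<in> carrier G"
  by (simp add: structure_gen_def structure_group_def presented_gen_closed)

lemma S_involutive:
  assumes "x \<in> X" "y \<in> X" "S (x, y) = (t, z)"
  shows "S (t, z) = (x, y)" "t \<in> X" "z \<in> X"
proof -
  show "S (t, z) = (x, y)"
    using symmetric assms by (force simp: symmetric_set_def involutive_def)
  have "S (x, y) \<in> X \<times> X"
    using symmetric assms(1,2)
    by (intro bij_betw_apply[of S "X \<times> X" "X \<times> X"]) (simp_all add: symmetric_set_def)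
  then show "t \<in> X" "z \<in> X" by (simp_all add: assms(3))
qed

lemma f_map_inject:
  assumes "f_map S y x = f_map S y x'" "x \<in> X" "x' \<in> X" "y \<in> X"
  shows "x = x'"
  using nondegenerate assms by (auto simp: nondegenerate_def bij_betw_def dest: inj_onD)

lemma g_map_inject:
  assumes "g_map S x y = g_map S x y'" "x \<in> X" "y \<in> X" "y' \<in> X"
  shows "y = y'"
  using nondegenerate assms by (auto simp: nondegenerate_def bij_betw_def dest: inj_onD)

lemma gen_relation:
  assumes "x \<in> X" "y \<in> X" "S (x, y) = (t, z)"
  shows "gen x \<otimes>\<^bsub>G\<^esub> gen y = gen t \<otimes>\<^bsub>G\<^esub> gen z"
proof -
  let ?R = "structure_relations X S"
  have w: "[(True, a)] \<in> words X" if "a \<in> X" for a using that by (simp add: words_def)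
  note tz = S_involutive(2,3)[OF assms]
  have "([(True, x), (True, y)], [(True, t), (True, z)]) \<in> pres_rel X ?R"
    using assms tz by (intro pres_rel.relation) (auto simp: structure_relations_def words_def)
  from equiv_class_eq[OF equiv_pres_rel this]
  show ?thesis
    using assms tz w
    by (simp add: structure_gen_def structure_group_def presented_gen_def presented_mult)
qed

text \<open>Read as \<open>S(f\<^sub>b\<^sup>-\<^sup>1(a), b) = (f\<^sub>a\<^sup>-\<^sup>1(b), a)\<close>: applying \<open>S\<close> once more must return the second
  component \<open>b\<close>, which pins down the first component of the image.\<close>

lemma S_swap:
  assumes X: "a \<in> X" "b \<in> X" "c \<in> X" "d \<in> X"
    and c: "f_map S b c = a" and d: "f_map S a d = b"
  shows "S (c, b) = (d, a)"
proof -
  obtain e where e: "S (c, b) = (e, a)" using c by (cases "S (c, b)") (simp add: f_map_def)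
  have "S (e, a) = (c, b)" "e \<in> X" using S_involutive[OF X(3,2) e] by auto
  then have "e = d" using f_map_inject[of a e d] X d by (simp add: f_map_def)
  then show ?thesis using e by simp
qed

text \<open>For \<open>d = f\<^sub>c\<^sup>-\<^sup>1(c)\<close> the exchange above degenerates to \<open>S(d, c) = (d, c)\<close>; thus
  \<open>g\<^sub>d(c) = d\<close>, and \<open>c = g\<^sub>d\<^sup>-\<^sup>1(d)\<close> is a function of \<open>d\<close>.\<close>

lemma f_map_diagonal_inject:
  assumes "c \<in> X" "c' \<in> X" "d \<in> X" "f_map S c d = c" "f_map S c' d = c'"
  shows "c = c'"
proof -
  have "S (d, c) = (d, c)" "S (d, c') = (d, c')"
    using assms by (auto intro: S_swap)
  then show ?thesis using assms g_map_inject[of d c c'] by (simp add: g_map_def)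
qed

section \<open>How the components of the homomorphism transform\<close>

lemma phi_closed:
  assumes "u \<in> carrier G"
  shows "perm u \<in> carrier (BijGroup X)" "Poly_Mapping.keys (transl u) \<subseteq> X"
  using phi.hom_closed[OF assms] by (cases "\<phi> u"; simp add: carrier_aut_semidirect)+

lemma perm_closed: "u \<in> carrier G \<Longrightarrow> z \<in> X \<Longrightarrow> perm u z \<in> X"
  by (rule BijGroup_apply_closed[OF phi_closed(1)])

lemma phi_gen_mult:
  assumes x: "x \<in> X" and u: "u \<in> carrier G"
  shows "perm (gen x \<otimes>\<^bsub>G\<^esub> u) = inv\<^bsub>BijGroup X\<^esub> (restrict (f_map S x) X) \<otimes>\<^bsub>BijGroup X\<^esub> perm u"
    and "transl (gen x \<otimes>\<^bsub>G\<^esub> u) = frag_of ((inv\<^bsub>BijGroup X\<^esub> perm u) x) + transl u"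
  using phi.hom_mult[OF gen_closed[OF x] u]
  by (cases "\<phi> u"; simp add: phi_generator[OF x] phi_gen_def mult_aut_semidirect)+

text \<open>This is \<open>s\<^bsub>xu\<^esub> = f\<^sub>x\<^sup>-\<^sup>1 s\<^sub>u\<close>, with \<open>f\<^sub>x\<close> moved to the left so that no inverse has to be
  evaluated later.\<close>

lemma f_map_perm_gen_mult:
  assumes x: "x \<in> X" and u: "u \<in> carrier G" and z: "z \<in> X"
  shows "f_map S x (perm (gen x \<otimes>\<^bsub>G\<^esub> u) z) = perm u z"
proof -
  let ?F = "restrict (f_map S x) X"
  have F: "?F \<in> carrier (BijGroup X)"
    using nondegenerate x by (auto simp: nondegenerate_def BijGroup_def Bij_def)
  have v: "gen x \<otimes>\<^bsub>G\<^esub> u \<in> carrier G" using gen_closed[OF x] u by simp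
  have "?F \<otimes>\<^bsub>BijGroup X\<^esub> perm (gen x \<otimes>\<^bsub>G\<^esub> u) = perm u"
    using F phi_closed(1)[OF u] by (simp add: phi_gen_mult(1)[OF x u] B.m_assoc[symmetric])
  moreover have "(?F \<otimes>\<^bsub>BijGroup X\<^esub> perm (gen x \<otimes>\<^bsub>G\<^esub> u)) z = f_map S x (perm (gen x \<otimes>\<^bsub>G\<^esub> u) z)"
    using F phi_closed(1)[OF v] z perm_closed[OF v z] by (simp add: BijGroup_def compose_def)
  ultimately show ?thesis by simp
qed

section \<open>Commuting injective translations of the structure group\<close>

text \<open>The operator \<open>A\<^sub>z(u) = s\<^sub>u(z) u\<close>. It is the identity outside the carriers so that all these
  operators commute as functions on the whole type, as folding over a multiset demands.\<close>

definition translate :: "'a \<Rightarrow> 'a word set \<Rightarrow> 'a word set" where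
  "translate z u = (if z \<in> X \<and> u \<in> carrier G then gen (perm u z) \<otimes>\<^bsub>G\<^esub> u else u)"

lemma translate_closed: "u \<in> carrier G \<Longrightarrow> translate z u \<in> carrier G"
  by (simp add: translate_def gen_closed perm_closed)

text \<open>Both composites equal \<open>u\<close> multiplied by two generators on the left, and the two pairs of
  generators are exchanged by \<open>S\<close>.\<close>

lemma translate_commute: "translate x (translate y u) = translate y (translate x u)"
proof (cases "x \<in> X \<and> y \<in> X \<and> u \<in> carrier G")
  case True
  then have x: "x \<in> X" and y: "y \<in> X" and u: "u \<in> carrier G" by auto
  define a where "a = perm u x"
  define b where "b = perm u y"
  have ab: "a \<in> X" "b \<in> X" using x y u by (auto simp: a_def b_def perm_closed)
  define c where "c = perm (gen b \<otimes>\<^bsub>G\<^esub> u) x"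
  define d where "d = perm (gen a \<otimes>\<^bsub>G\<^esub> u) y"
  have cd: "c \<in> X" "d \<in> X"
    using x y u ab by (auto simp: c_def d_def perm_closed gen_closed)
  have "f_map S b c = a" "f_map S a d = b"
    using x y u ab by (simp_all add: c_def d_def f_map_perm_gen_mult a_def b_def)
  then have "S (c, b) = (d, a)" using ab cd by (intro S_swap)
  then have "gen c \<otimes>\<^bsub>G\<^esub> gen b = gen d \<otimes>\<^bsub>G\<^esub> gen a" using ab cd by (intro gen_relation)
  then have "gen c \<otimes>\<^bsub>G\<^esub> (gen b \<otimes>\<^bsub>G\<^esub> u) = gen d \<otimes>\<^bsub>G\<^esub> (gen a \<otimes>\<^bsub>G\<^esub> u)"
    using ab cd u by (simp add: G.m_assoc[symmetric] gen_closed)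
  moreover have "translate x (translate y u) = gen c \<otimes>\<^bsub>G\<^esub> (gen b \<otimes>\<^bsub>G\<^esub> u)"
    "translate y (translate x u) = gen d \<otimes>\<^bsub>G\<^esub> (gen a \<otimes>\<^bsub>G\<^esub> u)"
    using x y u ab gen_closed by (auto simp: translate_def a_def b_def c_def d_def)
  ultimately show ?thesis by simp
next
  case False
  then show ?thesis using translate_closed by (auto simp: translate_def)
qed

sublocale translate: comp_fun_commute translate
  by unfold_locales (simp add: fun_eq_iff translate_commute)

lemma translate_inject:
  assumes "translate z u = translate z v" and u: "u \<in> carrier G" and v: "v \<in> carrier G"
  shows "u = v"
proof (cases "z \<in> X")
  case z: True
  define c where "c = perm u z"
  define c' where "c' = perm v z"
  define w where "w = gen c \<otimes>\<^bsub>G\<^esub> u"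
  have c: "c \<in> X" "c' \<in> X" using u v z by (auto simp: c_def c'_def perm_closed)
  have w': "w = gen c' \<otimes>\<^bsub>G\<^esub> v"
    using assms z by (simp add: translate_def w_def c_def c'_def)
  have "w \<in> carrier G" using c u by (simp add: w_def gen_closed)
  then have d: "perm w z \<in> X" using z by (rule perm_closed)
  have "f_map S c (perm w z) = c"
    unfolding w_def using f_map_perm_gen_mult[OF c(1) u z] by (simp add: c_def)
  moreover have "f_map S c' (perm w z) = c'"
    unfolding w' using f_map_perm_gen_mult[OF c(2) v z] by (simp add: c'_def)
  ultimately have "c = c'" using f_map_diagonal_inject[OF c d] by simp
  then have "gen c \<otimes>\<^bsub>G\<^esub> u = gen c \<otimes>\<^bsub>G\<^esub> v" using w' by (simp add: w_def)
  then show ?thesis using c u v by (simp add: gen_closed)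
next
  case False
  then show ?thesis using assms by (simp add: translate_def)
qed

lemma fold_translate_closed: "u \<in> carrier G \<Longrightarrow> fold_mset translate u M \<in> carrier G"
  by (induction M) (simp_all add: translate_closed)

lemma fold_translate_inject:
  assumes "fold_mset translate u M = fold_mset translate v M" "u \<in> carrier G" "v \<in> carrier G"
  shows "u = v"
  using assms by (induction M) (auto dest: translate_inject simp: fold_translate_closed)

section \<open>Reconstruction from the translation part\<close>

text \<open>The point \<open>z\<close> is \<open>s\<^sub>u\<^sup>-\<^sup>1(x)\<close>.\<close>

lemma gen_mult_eq_translate:
  assumes x: "x \<in> X" and u: "u \<in> carrier G"
  obtains z where "gen x \<otimes>\<^bsub>G\<^esub> u = translate z u" "transl (gen x \<otimes>\<^bsub>G\<^esub> u) = frag_of z + transl u"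
proof
  let ?i = "inv\<^bsub>BijGroup X\<^esub> perm u"
  have i: "?i \<in> carrier (BijGroup X)" using phi_closed(1)[OF u] by simp
  then have z: "?i x \<in> X" using x by (rule BijGroup_apply_closed)
  have "(perm u \<otimes>\<^bsub>BijGroup X\<^esub> ?i) x = perm u (?i x)"
    using phi_closed(1)[OF u] i x by (simp add: BijGroup_def compose_def)
  moreover have "perm u \<otimes>\<^bsub>BijGroup X\<^esub> ?i = \<one>\<^bsub>BijGroup X\<^esub>" using phi_closed(1)[OF u] by simp
  ultimately have "perm u (?i x) = x" using x by (simp add: BijGroup_def)
  then show "gen x \<otimes>\<^bsub>G\<^esub> u = translate (?i x) u" using z u by (simp add: translate_def)
  show "transl (gen x \<otimes>\<^bsub>G\<^esub> u) = frag_of (?i x) + transl u" by (rule phi_gen_mult(2)[OF x u])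
qed

text \<open>Multiplying by \<open>x\<close> enlarges \<open>P\<close>; multiplying by \<open>x\<^sup>-\<^sup>1\<close> enlarges \<open>N\<close>. Keeping the
  negative part on the side of \<open>g\<close> avoids inverting the operators.\<close>

lemma reconstruct_from_translation:
  assumes "g \<in> carrier G"
  shows "\<exists>N P. fold_mset translate g N = fold_mset translate \<one>\<^bsub>G\<^esub> P \<and>
    transl g + (\<Sum>x\<in>#N. frag_of x) = (\<Sum>x\<in>#P. frag_of x)"
  using assms[unfolded structure_group_def]
proof (induction rule: presented_group_induct)
  case one
  have "transl \<one>\<^bsub>G\<^esub> = 0" by (simp add: one_aut_semidirect)
  then show ?case by (intro exI[of _ "{#}"]) (simp add: structure_group_def)
next
  case (gen x u)
  then have x: "x \<in> X" and u: "u \<in> carrier G" by (simp_all add: structure_group_def)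
  obtain N P where NP: "fold_mset translate u N = fold_mset translate \<one>\<^bsub>G\<^esub> P"
    "transl u + (\<Sum>x\<in>#N. frag_of x) = (\<Sum>x\<in>#P. frag_of x)"
    using gen.IH by (auto simp: structure_group_def)
  obtain z where z: "gen x \<otimes>\<^bsub>G\<^esub> u = translate z u"
    "transl (gen x \<otimes>\<^bsub>G\<^esub> u) = frag_of z + transl u"
    using gen_mult_eq_translate[OF x u] .
  have "fold_mset translate (gen x \<otimes>\<^bsub>G\<^esub> u) N = fold_mset translate \<one>\<^bsub>G\<^esub> (add_mset z P)"
    using NP(1) by (simp add: z(1) translate.fold_mset_fun_left_comm[symmetric])
  moreover have "transl (gen x \<otimes>\<^bsub>G\<^esub> u) + (\<Sum>x\<in>#N. frag_of x) = (\<Sum>x\<in>#add_mset z P. frag_of x)"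
    using NP(2) by (simp add: z(2) add.assoc)
  ultimately show ?case
    unfolding structure_gen_def structure_group_def by blast
next
  case (inv_gen x u)
  then have x: "x \<in> X" and u: "u \<in> carrier G" by (simp_all add: structure_group_def)
  obtain N P where NP: "fold_mset translate u N = fold_mset translate \<one>\<^bsub>G\<^esub> P"
    "transl u + (\<Sum>x\<in>#N. frag_of x) = (\<Sum>x\<in>#P. frag_of x)"
    using inv_gen.IH by (auto simp: structure_group_def)
  let ?v = "inv\<^bsub>G\<^esub> gen x \<otimes>\<^bsub>G\<^esub> u"
  have v: "?v \<in> carrier G" using gen_closed[OF x] u by simp
  have xv: "gen x \<otimes>\<^bsub>G\<^esub> ?v = u" using gen_closed[OF x] u by (simp add: G.m_assoc[symmetric])
  obtain z where z: "u = translate z ?v" "transl u = frag_of z + transl ?v"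
    using gen_mult_eq_translate[OF x v] unfolding xv .
  have "fold_mset translate ?v (add_mset z N) = fold_mset translate \<one>\<^bsub>G\<^esub> P"
    using NP(1) by (simp add: translate.fold_mset_fun_left_comm z(1)[symmetric])
  moreover have "transl ?v + (\<Sum>x\<in>#add_mset z N. frag_of x) = (\<Sum>x\<in>#P. frag_of x)"
    using NP(2) by (simp add: z(2) ac_simps)
  ultimately show ?case
    unfolding structure_gen_def structure_group_def by blast
qed

lemma transl_eq_0_imp_one:
  assumes g: "g \<in> carrier G" and "transl g = 0"
  shows "g = \<one>\<^bsub>G\<^esub>"
proof -
  obtain N P where NP: "fold_mset translate g N = fold_mset translate \<one>\<^bsub>G\<^esub> P"
    "transl g + (\<Sum>x\<in>#N. frag_of x) = (\<Sum>x\<in>#P. frag_of x)"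
    using reconstruct_from_translation[OF g] by blast
  then have "N = P" using assms(2) by (simp add: sum_frag_of_inject)
  then show ?thesis using NP(1) g by (auto dest: fold_translate_inject)
qed

lemma phi_injective: "inj_on \<phi> (carrier G)"
proof -
  have "u = \<one>\<^bsub>G\<^esub>" if "u \<in> carrier G" "\<phi> u = \<one>\<^bsub>aut_semidirect X\<^esub>" for u
    using that by (intro transl_eq_0_imp_one) (simp_all add: one_aut_semidirect)
  then show ?thesis by (simp add: phi.inj_on_one_iff)
qed

end

theorem proposition2p4:
  fixes X :: "'a set" and S :: "'a \<times> 'a \<Rightarrow> 'a \<times> 'a"
    and \<phi> :: "'a word set \<Rightarrow> ('a \<Rightarrow> 'a) \<times> ('a \<Rightarrow>\<^sub>0 int)"
  assumes "symmetric_set X S"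
    and "nondegenerate X S"
    and "\<phi> \<in> hom (structure_group X S) (aut_semidirect X)"
    and "\<forall>x\<in>X. \<phi> (structure_gen X S x) = phi_gen X S x"
  shows "inj_on \<phi> (carrier (structure_group X S))"
proof -
  interpret structure_hom X S \<phi>
    using assms by unfold_locales auto
  show ?thesis by (rule phi_injective)
qed

end
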